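(* Let $T$ be a tree and let $l\colon V(T)\to[0,\infty)$ be a non-degenerate labeling. Then the following are equivalent: (1) the ultrametric space $(V(T), d_l)$ is totally bounded; (2) for every $\varepsilon>0$ the set $V_\varepsilon=\{v\in V(T)\colon l(v)\ge\varepsilon\}$ is finite, and $\delta_T(v)<\infty$ holds for every $v\in V(T)$ with $l(v)>0$.
   Context: A tree is a connected acyclic graph with nonempty vertex set; $\delta_T(v)$ denotes the degree of $v$ (the cardinality of the set of vertices adjacent to $v$). For a labeling $l\colon V(T)\to[0,\infty)$ define $d_l(u,u)=0$ and, for $u\neq v$, $d_l(u,v)=\max_{w\in V(P)} l(w)$, where $P$ is the unique path joining $u$ and $v$ in $T$. The labeling is non-degenerate if $\max\{l(u),l(v)\}>0$ for every edge $\{u,v\}$; then $d_l$ is an ultrametric. *)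

theory Defs
  imports "HOL-Analysis.Analysis" "HOL-Library.Extended_Nat" "Graph_Theory.Digraph_Component"
begin

text \<open>
  A simple graph, possibly infinite, is a loop-free symmetric digraph without parallel arcs: each
  edge \<open>{u, v}\<close> is the pair of arcs \<open>(u, v)\<close>, \<open>(v, u)\<close>. In this representation every edge gives the
  closed walk \<open>u, v, u\<close>, which \<^const>\<open>pre_digraph.cycle\<close> counts as a cycle (so the library's
  \<open>Digraph_Component.tree\<close> would exclude all edges). The cycles of the undirected graph
  are the directed cycles of length at least 3. Connectedness includes that the vertex set is
  nonempty.
\<close>

locale tree_graph = pair_bidirected_digraph T for T :: "'a pair_pre_digraph" +
  assumes tree_connected: "Digraph_Component.connected (with_proj T)"
    and tree_acyclic: "\<nexists>p. pre_digraph.cycle (with_proj T) p \<and> length p \<ge> 3"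

definition neighbours :: "'a pair_pre_digraph \<Rightarrow> 'a \<Rightarrow> 'a set" where
  "neighbours T v = {w \<in> pverts T. (v, w) \<in> parcs T}"

text \<open>All infinite cardinalities are identified with \<open>\<infinity>\<close>.\<close>

definition vdegree :: "'a pair_pre_digraph \<Rightarrow> 'a \<Rightarrow> enat" where
  "vdegree T v = (if finite (neighbours T v) then enat (card (neighbours T v)) else \<infinity>)"

definition labeling :: "'a pair_pre_digraph \<Rightarrow> ('a \<Rightarrow> real) \<Rightarrow> bool" where
  "labeling T l \<longleftrightarrow> (\<forall>v \<in> pverts T. 0 \<le> l v)"

definition nondegenerate :: "'a pair_pre_digraph \<Rightarrow> ('a \<Rightarrow> real) \<Rightarrow> bool" where
  "nondegenerate T l \<longleftrightarrow> (\<forall>u v. (u, v) \<in> parcs T \<longrightarrow> 0 < max (l u) (l v))"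

definition tree_path :: "'a pair_pre_digraph \<Rightarrow> 'a \<Rightarrow> 'a \<Rightarrow> ('a \<times> 'a) awalk" where
  "tree_path T u v = (THE p. pre_digraph.apath (with_proj T) u p v)"

text \<open>
  The value 0 outside the vertex set is a junk value: \<^locale>\<open>Metric_space\<close> demands nonnegativity
  and symmetry for all elements of the type.
\<close>

definition label_dist :: "'a pair_pre_digraph \<Rightarrow> ('a \<Rightarrow> real) \<Rightarrow> 'a \<Rightarrow> 'a \<Rightarrow> real" where
  "label_dist T l u v =
     (if u \<in> pverts T \<and> v \<in> pverts T \<and> u \<noteq> v
      then Max (l ` set (pre_digraph.awalk_verts (with_proj T) u (tree_path T u v)))
      else 0)"

context tree_graph
begin

lemma awalk_to_apath_verts_subset:
  assumes "awalk u p v"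
  shows "set (pawalk_verts u (awalk_to_apath p)) \<subseteq> set (pawalk_verts u p)"
proof -
  have "awalk u (awalk_to_apath p) v"
    using apath_awalk_to_apath[OF assms] by (rule awalkI_apath)
  from set_awalk_verts[OF this] show ?thesis
    unfolding set_awalk_verts[OF assms] using awalk_to_apath_subset[OF assms] by auto
qed

lemma no_bypass:
  assumes "(u, a) \<in> parcs T" "(u, b) \<in> parcs T" "a \<noteq> b" "awalk a w b"
  shows "u \<in> set (pawalk_verts a w)"
proof (rule ccontr)
  assume u: "u \<notin> set (pawalk_verts a w)"
  define r where "r = awalk_to_apath w"
  have r: "apath a r b" unfolding r_def using assms(4) by (rule apath_awalk_to_apath)
  have sub: "set (pawalk_verts a r) \<subseteq> set (pawalk_verts a w)"
    unfolding r_def using assms(4) by (rule awalk_to_apath_verts_subset)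
  have rne: "r \<noteq> []" using r assms(3) by (auto simp: apath_Nil_iff)
  have bu: "(b, u) \<in> parcs T" using assms(2) by (rule arcs_symmetric)
  have wr: "awalk a r b" and dr: "distinct (pawalk_verts a r)"
    using r by (auto simp: apath_def)
  have "awalk a (r @ [(b, u)]) u"
    using wr by (rule awalk_appendI) (use bu in \<open>auto simp: awalk_simps dest: in_arcsD2\<close>)
  moreover have "pawalk_verts a (r @ [(b, u)]) = pawalk_verts a r @ [u]"
    using awalk_verts_append[OF calculation] by simp
  ultimately have "cycle ((u, a) # r @ [(b, u)])"
    using assms(1) dr u sub by (auto simp: cycle_def awalk_Cons_iff intro!: exI[of _ u])
  moreover have "length ((u, a) # r @ [(b, u)]) \<ge> 3"
    using rne by (cases r) auto
  ultimately show False using tree_acyclic by blast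
qed

lemma apath_unique:
  assumes "apath u p v" "apath u q v"
  shows "p = q"
  using assms
proof (induction p arbitrary: u q)
  case Nil
  then show ?case using apath_ends by blast
next
  case (Cons e p)
  have "u \<noteq> v" using Cons.prems(1) apath_nonempty_ends by blast
  then obtain f q' where q: "q = f # q'" using Cons.prems(2) by (cases q) (auto simp: apath_Nil_iff)
  have e: "e \<in> parcs T" "fst e = u" "apath (snd e) p v" "u \<notin> set (pawalk_verts (snd e) p)"
    using Cons.prems(1) by (auto simp: apath_Cons_iff)
  have f: "f \<in> parcs T" "fst f = u" "apath (snd f) q' v" "u \<notin> set (pawalk_verts (snd f) q')"
    using Cons.prems(2) by (auto simp: q apath_Cons_iff)
  have ef: "snd e = snd f"
  proof (rule ccontr)
    assume ne: "snd e \<noteq> snd f"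
    have w1: "awalk (snd e) p v" and w2': "awalk (snd f) q' v"
      using e f by (auto simp: apath_def)
    have w2: "awalk v (rev_path q') (snd f)" using w2' by simp
    have "awalk (snd e) (p @ rev_path q') (snd f)"
      using w1 w2 by (rule awalk_appendI)
    then have "u \<in> set (pawalk_verts (snd e) (p @ rev_path q'))"
      using no_bypass[OF _ _ ne] e f by (metis prod.collapse)
    moreover have "set (pawalk_verts (snd e) (p @ rev_path q')) =
        set (pawalk_verts (snd e) p) \<union> set (pawalk_verts (snd f) q')"
      using set_awalk_verts_append[OF w1 w2] awalk_verts_rev_path[OF w2'] by simp
    ultimately show False using e f by auto
  qed
  then have "p = q'" using Cons.IH e f by auto
  then show ?case using ef e(2) f(2) q by (simp add: prod_eq_iff)
qed

lemma apath_tree_path: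
  assumes "u \<in> pverts T" "v \<in> pverts T"
  shows "apath u (tree_path T u v) v"
proof -
  have "parcs (mk_symmetric (with_proj T)) = parcs T"
    by (auto simp: mk_symmetric_def intro: arcs_symmetric)
  moreover have "pverts (mk_symmetric (with_proj T)) = pverts T"
    by (simp add: mk_symmetric_def)
  ultimately have "mk_symmetric (with_proj T) = T" by simp
  then have "u \<rightarrow>\<^sup>*\<^bsub>with_proj T\<^esub> v"
    using tree_connected assms unfolding Digraph_Component.connected_def strongly_connected_def by simp
  then obtain p where p: "apath u p v" using reachable_apath by auto
  show ?thesis
    unfolding tree_path_def by (rule theI) (rule p, rule apath_unique[OF _ p])
qed

lemma tree_path_subset:
  assumes "awalk u p v"
  shows "set (pawalk_verts u (tree_path T u v)) \<subseteq> set (pawalk_verts u p)"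
proof -
  have ends: "u \<in> pverts T" "v \<in> pverts T" using assms by auto
  have "tree_path T u v = awalk_to_apath p"
    using apath_tree_path[OF ends] apath_awalk_to_apath[OF assms] by (rule apath_unique)
  then show ?thesis using awalk_to_apath_verts_subset[OF assms] by simp
qed

lemma tree_path_commute:
  assumes "u \<in> pverts T" "v \<in> pverts T"
  shows "set (pawalk_verts v (tree_path T v u)) = set (pawalk_verts u (tree_path T u v))"
proof -
  have p: "apath u (tree_path T u v) v" using assms by (rule apath_tree_path)
  have "apath v (rev_path (tree_path T u v)) u" using p by simp
  then have "tree_path T v u = rev_path (tree_path T u v)"
    using apath_tree_path assms apath_unique by blast
  moreover have "awalk u (tree_path T u v) v" using p by (rule awalkI_apath)
  ultimately show ?thesis using awalk_verts_rev_path[of u "tree_path T u v" v] by simp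
qed

lemma label_dist_commute: "label_dist T l u v = label_dist T l v u"
  using tree_path_commute[of u v] by (cases "u \<in> pverts T \<and> v \<in> pverts T") (auto simp: label_dist_def)

lemma label_dist_pos:
  assumes "labeling T l" "nondegenerate T l" "u \<in> pverts T" "v \<in> pverts T" "u \<noteq> v"
  shows "0 < label_dist T l u v"
proof -
  have p: "apath u (tree_path T u v) v" using assms(3,4) by (rule apath_tree_path)
  obtain e r where er: "tree_path T u v = e # r"
    using p assms(5) by (cases "tree_path T u v") (auto simp: apath_Nil_iff)
  have e: "e \<in> parcs T" and sub: "fst e \<in> set (pawalk_verts u (e # r))"
      "snd e \<in> set (pawalk_verts u (e # r))"
    using p er by (cases r; auto simp: apath_Cons_iff apath_Nil_iff)+
  have "0 < max (l (fst e)) (l (snd e))"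
    using assms(2) e unfolding nondegenerate_def by (metis prod.collapse)
  then obtain x where "x \<in> set (pawalk_verts u (tree_path T u v))" "0 < l x"
    using sub er by (metis less_max_iff_disj)
  then show ?thesis using assms(3-5) by (auto simp: label_dist_def Max_gr_iff)
qed

lemma label_dist_nonneg:
  assumes "labeling T l" "nondegenerate T l"
  shows "0 \<le> label_dist T l u v"
proof (cases "u \<in> pverts T \<and> v \<in> pverts T \<and> u \<noteq> v")
  case True
  then show ?thesis using label_dist_pos[OF assms, of u v] by simp
qed (auto simp: label_dist_def)

lemma label_dist_ultrametric:
  assumes "labeling T l" "nondegenerate T l"
    and V: "u \<in> pverts T" "v \<in> pverts T" "w \<in> pverts T"
  shows "label_dist T l u w \<le> max (label_dist T l u v) (label_dist T l v w)"
proof (cases "u = v \<or> v = w \<or> u = w")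
  case True
  moreover have "label_dist T l x x = 0" for x by (simp add: label_dist_def)
  ultimately show ?thesis using label_dist_nonneg[OF assms(1,2), of u v] by (elim disjE) auto
next
  case False
  let ?P = "\<lambda>a b. set (pawalk_verts a (tree_path T a b))"
  have w1: "awalk u (tree_path T u v) v" and w2: "awalk v (tree_path T v w) w"
    using V apath_tree_path awalkI_apath by auto
  have "?P u w \<subseteq> ?P u v \<union> ?P v w"
    using tree_path_subset[OF awalk_appendI[OF w1 w2]] set_awalk_verts_append[OF w1 w2] by simp
  then have "Max (l ` ?P u w) \<le> Max (l ` (?P u v \<union> ?P v w))"
    by (intro Max_mono) auto
  also have "\<dots> = max (Max (l ` ?P u v)) (Max (l ` ?P v w))"
    by (simp add: image_Un Max_Un)
  finally show ?thesis using False V by (simp add: label_dist_def)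
qed

lemma label_dist_Metric_space:
  assumes "labeling T l" "nondegenerate T l"
  shows "Metric_space (pverts T) (label_dist T l)"
proof
  show "0 \<le> label_dist T l x y" for x y
    using assms by (rule label_dist_nonneg)
  show "label_dist T l x y = label_dist T l y x" for x y
    by (rule label_dist_commute)
  show "label_dist T l x y = 0 \<longleftrightarrow> x = y" if "x \<in> pverts T" "y \<in> pverts T" for x y
  proof (cases "x = y")
    case False
    then show ?thesis using label_dist_pos[OF assms that] by simp
  qed (simp add: label_dist_def)
  show "label_dist T l x z \<le> label_dist T l x y + label_dist T l y z"
    if "x \<in> pverts T" "y \<in> pverts T" "z \<in> pverts T" for x y z
    using label_dist_ultrametric[OF assms that] label_dist_nonneg[OF assms, of x y]
      label_dist_nonneg[OF assms, of y z] by linarith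
qed

end

end

theory Submission
  imports Defs
begin

text \<open>
  A totally bounded space contains no infinite separated set, whereas both an infinite set of
  vertices with labels at least \<open>\<epsilon>\<close> and the neighbours of a vertex \<open>v\<close> of infinite degree (pairwise
  joined through \<open>v\<close>) are separated. Conversely, fix a vertex \<open>x\<^sub>0\<close>. Follow the path from a vertex
  outside the finite set \<open>V\<^sub>\<epsilon>\<close> to \<open>x\<^sub>0\<close> and stop just before it enters \<open>V\<^sub>\<epsilon>\<close>: the stopping point is
  at distance less than \<open>\<epsilon>\<close> and is either \<open>x\<^sub>0\<close> or one of the finitely many neighbours of \<open>V\<^sub>\<epsilon>\<close>.
\<close>

text \<open>A ball of radius \<open>r/2\<close> contains at most one point of \<open>A\<close>,
  because two of its points are less than \<open>r\<close> apart; finitely many such balls cover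
  \<open>A\<close>.\<close>

lemma (in Metric_space) mtotally_bounded_imp_finite_separated:
  assumes "mtotally_bounded S" "A \<subseteq> S" "r > 0"
    and sep: "\<And>x y. x \<in> A \<Longrightarrow> y \<in> A \<Longrightarrow> x \<noteq> y \<Longrightarrow> r \<le> d x y"
  shows "finite A"
proof -
  have "mtotally_bounded A" using assms(1,2) mtotally_bounded_subset by blast
  then obtain K where K: "finite K" "A \<subseteq> (\<Union>c\<in>K. mball c (r/2))"
    using \<open>r > 0\<close> unfolding mtotally_bounded_def by (meson half_gt_zero)
  have "finite (A \<inter> mball c (r/2))" for c
  proof -
    have "x = y" if "x \<in> A \<inter> mball c (r/2)" "y \<in> A \<inter> mball c (r/2)" for x y
    proof (rule ccontr)
      assume "x \<noteq> y"
      then have "r \<le> d x y" using that sep by blast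
      also have "d x y \<le> d c x + d c y" using that triangle'' by (auto simp: in_mball)
      also have "\<dots> < r" using that by (auto simp: in_mball)
      finally show False by simp
    qed
    then have "is_singleton (A \<inter> mball c (r/2)) \<or> A \<inter> mball c (r/2) = {}"
      by (metis equals0I is_singletonI')
    then show ?thesis by (auto simp: is_singleton_def)
  qed
  then have "finite (\<Union>c\<in>K. A \<inter> mball c (r/2))" using K(1) by blast
  then show ?thesis using K(2) by (rule_tac finite_subset) auto
qed

lemma vdegree_finite_iff: "vdegree T v < \<infinity> \<longleftrightarrow> finite (neighbours T v)"
  by (simp add: vdegree_def)

context tree_graph
begin

lemma label_le_label_dist:
  assumes "u \<in> pverts T" "v \<in> pverts T" "u \<noteq> v"
    and "x \<in> set (pawalk_verts u (tree_path T u v))"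
  shows "l x \<le> label_dist T l u v"
  using assms by (simp add: label_dist_def)

lemma label_le_label_dist_start:
  assumes "u \<in> pverts T" "v \<in> pverts T" "u \<noteq> v"
  shows "l u \<le> label_dist T l u v"
  using assms apath_tree_path by (intro label_le_label_dist hd_in_awalk_verts) auto

text \<open>A walk from \<open>a\<close> to \<open>b\<close> avoiding \<open>v\<close> would close
  up to a cycle through the two edges at \<open>v\<close>, so the tree path has to visit
  \<open>v\<close>.\<close>

lemma label_le_label_dist_neighbours:
  assumes "a \<in> neighbours T v" "b \<in> neighbours T v" "a \<noteq> b"
  shows "l v \<le> label_dist T l a b"
proof (rule label_le_label_dist)
  show V: "a \<in> pverts T" "b \<in> pverts T" using assms by (auto simp: neighbours_def)
  show "v \<in> set (pawalk_verts a (tree_path T a b))"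
    using assms V by (intro no_bypass[of v a b]) (auto simp: neighbours_def intro: awalkI_apath apath_tree_path)
qed fact

text \<open>The edge is itself a walk, and the tree path visits only vertices of any walk with the
  same ends.\<close>

lemma label_dist_edge_less:
  assumes "(u, v) \<in> parcs T" "l u < \<epsilon>" "l v < \<epsilon>" "\<epsilon> > 0"
  shows "label_dist T l u v < \<epsilon>"
proof -
  have "awalk u [(u, v)] v" using assms(1) by (auto simp: awalk_simps dest: in_arcsD1 in_arcsD2)
  from tree_path_subset[OF this]
  have "set (pawalk_verts u (tree_path T u v)) \<subseteq> {u, v}" by simp
  then show ?thesis using assms(2-4) by (auto simp: label_dist_def)
qed

lemma awalk_imp_close_exit:
  assumes "labeling T l" "nondegenerate T l" "\<epsilon> > 0"
    and "awalk v p z" "l v < \<epsilon>"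
  shows "\<exists>w \<in> insert z (\<Union>k\<in>{k \<in> pverts T. l k \<ge> \<epsilon>}. neighbours T k).
    w \<in> pverts T \<and> label_dist T l v w < \<epsilon>"
  using assms(4,5)
proof (induction p arbitrary: v)
  case Nil
  then show ?case using \<open>\<epsilon> > 0\<close> by (auto simp: awalk_Nil_iff label_dist_def)
next
  case (Cons e p)
  let ?x = "snd e"
  have e: "(v, ?x) \<in> parcs T" and w: "awalk ?x p z" and V: "v \<in> pverts T" "?x \<in> pverts T"
    using Cons.prems(1) by (auto simp: awalk_Cons_iff)
  show ?case
  proof (cases "l ?x < \<epsilon>")
    case True
    from Cons.IH[OF w True] obtain y where
      y: "y \<in> insert z (\<Union>k\<in>{k \<in> pverts T. l k \<ge> \<epsilon>}. neighbours T k)"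
        "y \<in> pverts T" "label_dist T l ?x y < \<epsilon>" by blast
    moreover have "label_dist T l v ?x < \<epsilon>"
      using e Cons.prems(2) True \<open>\<epsilon> > 0\<close> by (rule label_dist_edge_less)
    \<comment> \<open>The ultrametric inequality yields a maximum, not a sum, so the bound
      \<epsilon> survives however many edges are followed.\<close>
    ultimately have "label_dist T l v y < \<epsilon>"
      using label_dist_ultrametric[OF assms(1,2) V y(2)] by linarith
    then show ?thesis using y by blast
  next
    case False
    \<comment> \<open>The next vertex has label at least \<epsilon>, so the walk stops here:
      \<open>v\<close> is its own witness, at distance 0.\<close>
    have "v \<in> neighbours T ?x"
      using arcs_symmetric[OF e] V by (simp add: neighbours_def)
    then show ?thesis using False V \<open>\<epsilon> > 0\<close>
      by (intro bexI[of _ v]) (auto simp: label_dist_def)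
  qed
qed

lemma mtotally_bounded_label_dist_iff:
  assumes "labeling T l" "nondegenerate T l"
  shows "Metric_space.mtotally_bounded (pverts T) (label_dist T l) (pverts T) \<longleftrightarrow>
    (\<forall>\<epsilon>>0. finite {v \<in> pverts T. l v \<ge> \<epsilon>}) \<and>
    (\<forall>v \<in> pverts T. l v > 0 \<longrightarrow> finite (neighbours T v))"
proof -
  interpret M: Metric_space "pverts T" "label_dist T l"
    using assms by (rule label_dist_Metric_space)
  show ?thesis
  proof (intro iffI conjI allI ballI impI)
    fix \<epsilon> :: real
    assume "M.mtotally_bounded (pverts T)" "\<epsilon> > 0"
    \<comment> \<open>Separation constant \<epsilon>: a distance between distinct vertices is at
      least the label of an endpoint.\<close>
    then show "finite {v \<in> pverts T. l v \<ge> \<epsilon>}"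
      by (elim M.mtotally_bounded_imp_finite_separated)
        (auto intro: order_trans label_le_label_dist_start)
  next
    fix v
    assume "M.mtotally_bounded (pverts T)" "l v > 0"
    \<comment> \<open>Separation constant \<open>l v\<close>.\<close>
    then show "finite (neighbours T v)"
      by (elim M.mtotally_bounded_imp_finite_separated)
        (auto simp: neighbours_def intro: label_le_label_dist_neighbours)
  next
    assume R: "(\<forall>\<epsilon>>0. finite {v \<in> pverts T. l v \<ge> \<epsilon>}) \<and>
      (\<forall>v \<in> pverts T. l v > 0 \<longrightarrow> finite (neighbours T v))"
    obtain z where z: "z \<in> pverts T"
      using tree_connected by (auto simp: Digraph_Component.connected_def strongly_connected_def)
    show "M.mtotally_bounded (pverts T)"
      unfolding M.mtotally_bounded_def
    proof (intro allI impI)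
      fix \<epsilon> :: real
      assume "\<epsilon> > 0"
      let ?V = "{k \<in> pverts T. l k \<ge> \<epsilon>}"
      \<comment> \<open>The centres of the \<epsilon>-net: vertices of \<open>?V\<close> cover
        themselves, all others are close to an exit point. Labels on \<open>?V\<close> are positive,
        so the neighbour sets in the union are finite.\<close>
      let ?F = "?V \<union> insert z (\<Union>k\<in>?V. neighbours T k)"
      have "finite ?F" using R \<open>\<epsilon> > 0\<close> by auto
      moreover have "?F \<subseteq> pverts T" using z by (auto simp: neighbours_def)
      moreover have "\<exists>c\<in>?F. v \<in> M.mball c \<epsilon>" if v: "v \<in> pverts T" for v
      proof (cases "l v < \<epsilon>")
        case True
        have "awalk v (tree_path T v z) z" using v z by (intro awalkI_apath apath_tree_path)
        from awalk_imp_close_exit[OF assms \<open>\<epsilon> > 0\<close> this True]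
        show ?thesis using v by (auto simp: M.in_mball label_dist_commute[of l v])
      next
        case False
        then show ?thesis using v \<open>\<epsilon> > 0\<close> by (intro bexI[of _ v]) auto
      qed
      ultimately show "\<exists>K. finite K \<and> K \<subseteq> pverts T \<and> pverts T \<subseteq> (\<Union>c\<in>K. M.mball c \<epsilon>)"
        by (intro exI[of _ ?F]) blast
    qed
  qed
qed

end

theorem theorem4p15:
  fixes T :: "'a pair_pre_digraph" and l :: "'a \<Rightarrow> real"
  assumes "tree_graph T" and "labeling T l" and "nondegenerate T l"
  shows "Metric_space.mtotally_bounded (pverts T) (label_dist T l) (pverts T) \<longleftrightarrow>
    (\<forall>\<epsilon>>0. finite {v \<in> pverts T. l v \<ge> \<epsilon>}) \<and>
    (\<forall>v \<in> pverts T. l v > 0 \<longrightarrow> vdegree T v < \<infinity>)"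
  unfolding vdegree_finite_iff
  using assms by (rule tree_graph.mtotally_bounded_label_dist_iff)

end
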